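(* Let $\Delta_n=\{x\in\mathbb{R}^n:\sum_{i=1}^n x_i=1,\ x_i\ge0\ \forall i\in[n]\}$ be the $(n-1)$-dimensional simplex, and fix $x_0\in\Delta_n$ and $w\in\mathbb{R}^n$. Then the projections curve $g(\lambda)=\Pi_{\Delta_n}(x_0-\lambda w)$ has only $O(n)$ breakpoints (for $\lambda\ge0$).
   Context: $\Pi_{\Delta_n}$ is Euclidean projection onto $\Delta_n$. The curve $g$ is continuous and piecewise affine in $\lambda$; its breakpoints are the successive end points of the maximal $\lambda$-intervals on which $g$ is affine and non-constant. The $O(\cdot)$ constant is absolute. *)

theory Defs
  imports "HOL-Analysis.Analysis"
begin

text \<open>
  The bound has to be uniform in the dimension \<open>n\<close>, so \<open>n\<close> is a natural number rather
  than a type: a point of \<open>n\<close>-space is an element of \<^term>\<open>topspace (Euclidean_space n)\<close>,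
  i.e. a function \<open>x :: nat \<Rightarrow> real\<close> with \<open>x i = 0\<close> for all \<open>i \<ge> n\<close>. Coordinates are
  numbered \<open>0, \<dots>, n - 1\<close>. The metric that the type class \<open>metric_space\<close> provides on
  functions is not the Euclidean one; \<^term>\<open>L2_set\<close> is used instead.
\<close>

definition unit_simplex :: "nat \<Rightarrow> (nat \<Rightarrow> real) set" where
  "unit_simplex n =
     {x \<in> topspace (Euclidean_space n). (\<Sum>i<n. x i) = 1 \<and> (\<forall>i<n. 0 \<le> x i)}"

definition euclidean_projection :: "nat \<Rightarrow> (nat \<Rightarrow> real) set \<Rightarrow> (nat \<Rightarrow> real) \<Rightarrow> nat \<Rightarrow> real" where
  "euclidean_projection n S a = arg_min_on (\<lambda>y. L2_set (\<lambda>i. a i - y i) {..<n}) S"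

definition projections_curve :: "nat \<Rightarrow> (nat \<Rightarrow> real) \<Rightarrow> (nat \<Rightarrow> real) \<Rightarrow> real \<Rightarrow> nat \<Rightarrow> real" where
  "projections_curve n x0 w t =
     euclidean_projection n (unit_simplex n) (\<lambda>i. x0 i - t * w i)"

definition affine_curve_on :: "real set \<Rightarrow> (real \<Rightarrow> nat \<Rightarrow> real) \<Rightarrow> bool" where
  "affine_curve_on I g \<longleftrightarrow> (\<exists>a b. \<forall>t\<in>I. \<forall>i. g t i = a i + t * b i)"

definition nonconst_affine_interval :: "(real \<Rightarrow> nat \<Rightarrow> real) \<Rightarrow> real set \<Rightarrow> bool" where
  "nonconst_affine_interval g I \<longleftrightarrow>
     is_interval I \<and> I \<subseteq> {0..} \<and> affine_curve_on I g \<and> \<not> g constant_on I"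

definition maximal_nonconst_affine_interval :: "(real \<Rightarrow> nat \<Rightarrow> real) \<Rightarrow> real set \<Rightarrow> bool" where
  "maximal_nonconst_affine_interval g I \<longleftrightarrow>
     nonconst_affine_interval g I \<and> (\<forall>J. nonconst_affine_interval g J \<and> I \<subseteq> J \<longrightarrow> J = I)"

text \<open>
  The frontier of an interval of reals consists of its finite end points. The start point
  \<open>0\<close> of the curve counts as a breakpoint if a maximal interval starts there.
\<close>

definition breakpoints :: "(real \<Rightarrow> nat \<Rightarrow> real) \<Rightarrow> real set" where
  "breakpoints g = (\<Union>I \<in> {I. maximal_nonconst_affine_interval g I}. frontier I)"

end

theory Submission
  imports Defs
begin

text \<open>
  The projection of a vector \<open>a\<close> onto the simplex is obtained by lowering all coordinates
  by a common threshold \<open>\<mu>\<close> and cutting off at zero; \<open>\<mu>\<close> is the solution of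
  \<open>(\<Sum>i<n. max 0 (a i - \<mu>)) = 1\<close> (\<open>simplex_threshold_exists\<close>,
  \<open>euclidean_projection_unit_simplex\<close>). The left-hand side is jointly convex in \<open>(a, \<mu>)\<close>
  and decreasing in \<open>\<mu>\<close>, so its sublevel set at height 1 is the epigraph of the threshold:
  the threshold is a convex function of \<open>a\<close> (\<open>simplex_threshold_convex\<close>).

  Along the line \<open>a = x0 - t w\<close> the threshold is therefore convex in \<open>t\<close>, while each coordinate
  of \<open>a\<close> is affine in \<open>t\<close>. Coordinate \<open>i\<close> of the curve is positive where its affine function
  exceeds the convex threshold, and this happens on an interval
  (\<open>is_interval_positive_coordinate\<close>). So each coordinate enters the support at most once and
  leaves it at most once. As long as the support does not change, the equation for the threshold
  is linear and the curve is affine (\<open>affine_curve_on_constant_support\<close>). An affine piece around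
  an end point of a maximal interval could be glued to that interval
  (\<open>disjoint_frontier_maximal_nonconst_affine_interval\<close>), so every breakpoint is one of the
  at most \<open>2 n\<close> times at which the support changes.
\<close>

section \<open>Intervals of reals and affine curves\<close>

text \<open>
  Of three frontier points the middle one would be interior to the closure, and a convex set
  has the same interior as its closure.
\<close>

lemma card_frontier_is_interval_le_2:
  fixes S :: "real set"
  assumes "is_interval S"
  shows "finite (frontier S) \<and> card (frontier S) \<le> 2"
proof (rule ccontr)
  assume "\<not> ?thesis"
  then have "infinite (frontier S) \<or> 3 \<le> card (frontier S)"
    by linarith
  then obtain T where T: "T \<subseteq> frontier S" "card T = 3"
    by (meson infinite_arbitrarily_large obtain_subset_with_card_n)
  then have finT: "finite T"
    by (simp add: card_ge_0_finite)
  obtain a b c where abc: "a \<in> T" "b \<in> T" "c \<in> T" "a < b" "b < c"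
  proof -
    obtain x y z where "T = {x, y, z}" "x \<noteq> y" "y \<noteq> z" "x \<noteq> z"
      using T(2) by (auto simp: card_3_iff)
    then show ?thesis
      using that by (metis insertCI linorder_neqE_linordered_idom)
  qed
  have conv: "convex S"
    using assms by (simp add: is_interval_convex_1)
  have "is_interval (closure S)"
    using convex_closure[OF conv] by (simp add: is_interval_convex_1)
  moreover have "a \<in> closure S" "c \<in> closure S"
    using T(1) abc by (auto simp: frontier_def)
  ultimately have "{a<..<c} \<subseteq> closure S"
    unfolding is_interval_1 by (meson greaterThanLessThan_iff less_imp_le subsetI)
  then have "b \<in> interior (closure S)"
    using abc by (intro interiorI[of "{a<..<c}"]) auto
  then have "b \<in> interior S"
    using convex_interior_closure[OF conv] by simp
  then show False
    using T(1) abc by (auto simp: frontier_def)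
qed

lemma affine_curve_on_Un:
  assumes "affine_curve_on I g" "affine_curve_on J g"
    and "s \<in> I \<inter> J" "t \<in> I \<inter> J" "s \<noteq> t"
  shows "affine_curve_on (I \<union> J) g"
proof -
  obtain a b where ab: "\<And>r i. r \<in> I \<Longrightarrow> g r i = a i + r * b i"
    using assms(1) unfolding affine_curve_on_def by blast
  obtain c d where cd: "\<And>r i. r \<in> J \<Longrightarrow> g r i = c i + r * d i"
    using assms(2) unfolding affine_curve_on_def by blast
  have slope: "b i = d i" for i
  proof -
    have "a i + s * b i = c i + s * d i" "a i + t * b i = c i + t * d i"
      using ab[of s i] ab[of t i] cd[of s i] cd[of t i] assms(3,4) by auto
    then have "(s - t) * (b i - d i) = 0"
      by (simp add: algebra_simps)
    then show ?thesis
      using assms(5) by simp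
  qed
  moreover have "a i = c i" for i
    using ab[of s i] cd[of s i] assms(3) slope[of i] by auto
  ultimately have "\<forall>r\<in>I \<union> J. \<forall>i. g r i = a i + r * b i"
    using ab cd by auto
  then show ?thesis
    unfolding affine_curve_on_def by blast
qed

text \<open>
  If \<open>p\<close> were a common point of \<open>U\<close> and the frontier of \<open>I\<close>, then \<open>I\<close> and \<open>U\<close> would share more
  than one point, so \<open>I \<union> U\<close> would be a larger interval on which the curve is affine.
\<close>

lemma disjoint_frontier_maximal_nonconst_affine_interval:
  assumes I: "maximal_nonconst_affine_interval g I"
    and U: "open U" "is_interval U" "U \<subseteq> {0..}" "affine_curve_on U g"
  shows "U \<inter> frontier I = {}"
proof (rule ccontr)
  assume "U \<inter> frontier I \<noteq> {}"
  then obtain p where p: "p \<in> U" "p \<in> closure I" "p \<notin> interior I"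
    by (auto simp: frontier_def)
  have I': "is_interval I" "I \<subseteq> {0..}" "affine_curve_on I g" "\<not> g constant_on I"
    using I by (auto simp: maximal_nonconst_affine_interval_def nonconst_affine_interval_def)
  obtain q where q: "q \<in> I" "q \<noteq> p"
    using I'(4) by (metis (mono_tags, lifting) constant_on_def)
  have "p islimpt I"
  proof (cases "p \<in> I")
    case True
    have "connected I" "\<nexists>a. I = {a}"
      using I'(1) q True by (auto simp: is_interval_connected_1)
    then show ?thesis
      using True connected_imp_perfect by blast
  next
    case False
    then show ?thesis
      using p(2) by (simp add: closure_def)
  qed
  then have "infinite (U \<inter> I)"
    using p(1) U(1) by (auto simp: islimpt_eq_acc_point)
  then have "\<not> (\<exists>r. U \<inter> I \<subseteq> {r})"
    by (meson finite.emptyI finite.insertI finite_subset)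
  then obtain s t where st: "s \<in> I \<inter> U" "t \<in> I \<inter> U" "s \<noteq> t"
    by blast
  have "affine_curve_on (I \<union> U) g"
    by (rule affine_curve_on_Un[OF I'(3) U(4) st])
  moreover have "is_interval (I \<union> U)"
    using I'(1) U(2) st(1) unfolding is_interval_connected_1 by (intro connected_Un) auto
  moreover have "\<not> g constant_on (I \<union> U)"
    using I'(4) constant_on_subset by blast
  ultimately have "nonconst_affine_interval g (I \<union> U)"
    using I'(2) U(3) by (simp add: nonconst_affine_interval_def)
  then have "I \<union> U = I"
    using I unfolding maximal_nonconst_affine_interval_def by blast
  then have "U \<subseteq> I"
    by blast
  then have "p \<in> interior I"
    using p(1) U(1) by (meson interiorI)
  then show False
    using p(3) by contradiction
qed

section \<open>Projection onto the simplex by thresholding\<close>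

lemma simplex_threshold_exists:
  fixes a :: "nat \<Rightarrow> real"
  assumes "0 < n"
  shows "\<exists>\<mu>. (\<Sum>i<n. max 0 (a i - \<mu>)) = 1"
proof -
  define F where "F \<mu> = (\<Sum>i<n. max 0 (a i - \<mu>))" for \<mu>
  define M where "M = Max (a ` {..<n})"
  have le_M: "a i \<le> M" if "i < n" for i
    using that by (auto simp: M_def)
  have "F M = 0"
    unfolding F_def using le_M by (intro sum.neutral) auto
  moreover have "1 \<le> F (a 0 - 1)"
    unfolding F_def
    using assms member_le_sum[of 0 "{..<n}" "\<lambda>i. max 0 (a i - (a 0 - 1))"] by auto
  moreover have "a 0 - 1 \<le> M"
    using le_M[OF assms] by simp
  moreover have "continuous_on {a 0 - 1..M} F"
    unfolding F_def by (intro continuous_intros)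
  ultimately obtain \<mu> where "F \<mu> = 1"
    using IVT2'[of F M 1 "a 0 - 1"] by auto
  then show ?thesis
    unfolding F_def by blast
qed

text \<open>
  The cut-off vector \<open>y\<close> satisfies the variational inequality
  \<open>(\<Sum>i<n. (a i - y i) * (y i - z i)) \<ge> 0\<close> for every \<open>z\<close> in the simplex: \<open>y\<close> and \<open>z\<close> have
  the same coordinate sum, so subtracting \<open>\<mu>\<close> from all \<open>a i - y i\<close> does not change this sum, but
  it makes each summand nonnegative. Hence \<open>z\<close> is farther from \<open>a\<close> than \<open>y\<close> by at least
  \<open>(\<Sum>i<n. (y i - z i)\<^sup>2)\<close> in squared distance, and \<open>y\<close> is the unique minimiser.
\<close>

lemma euclidean_projection_unit_simplex:
  fixes a :: "nat \<Rightarrow> real"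
  assumes \<mu>: "(\<Sum>i<n. max 0 (a i - \<mu>)) = 1"
  shows "euclidean_projection n (unit_simplex n) a = (\<lambda>i. if i < n then max 0 (a i - \<mu>) else 0)"
proof -
  define y where "y = (\<lambda>i. if i < n then max 0 (a i - \<mu>) else 0)"
  define d where "d = (\<lambda>z. L2_set (\<lambda>i. a i - z i) {..<n})"
  have sum_y: "(\<Sum>i<n. y i) = 1"
    using \<mu> by (simp add: y_def)
  have y_in: "y \<in> unit_simplex n"
    using sum_y by (auto simp: unit_simplex_def topspace_Euclidean_space y_def)
  have closer: "d y < d z" if z: "z \<in> unit_simplex n" "z \<noteq> y" for z
  proof -
    have z_nonneg: "0 \<le> z i" if "i < n" for i
      using z(1) that by (simp add: unit_simplex_def)
    have sum_z: "(\<Sum>i<n. z i) = 1"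
      using z(1) by (simp add: unit_simplex_def)
    have "0 \<le> (\<Sum>i<n. (a i - y i - \<mu>) * (y i - z i))"
    proof (rule sum_nonneg)
      fix i assume "i \<in> {..<n}"
      then show "0 \<le> (a i - y i - \<mu>) * (y i - z i)"
        using z_nonneg[of i] by (auto simp: y_def max_def mult_nonpos_nonneg mult_nonpos_nonpos)
    qed
    also have "\<dots> = (\<Sum>i<n. (a i - y i) * (y i - z i) - \<mu> * (y i - z i))"
      by (intro sum.cong refl) (simp add: algebra_simps)
    also have "\<dots> = (\<Sum>i<n. (a i - y i) * (y i - z i)) - \<mu> * ((\<Sum>i<n. y i) - (\<Sum>i<n. z i))"
      by (simp add: sum_subtractf flip: sum_distrib_left)
    finally have variational: "0 \<le> (\<Sum>i<n. (a i - y i) * (y i - z i))"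
      by (simp add: sum_y sum_z)
    obtain j where j: "y j \<noteq> z j"
      using z(2) by fastforce
    moreover have "y j = z j" if "n \<le> j"
      using z(1) that by (simp add: y_def unit_simplex_def topspace_Euclidean_space)
    ultimately have "j < n"
      by (meson not_less)
    then have "0 < (\<Sum>i<n. (y i - z i)\<^sup>2)"
      using j by (intro sum_pos2[of _ j]) auto
    moreover have "(\<Sum>i<n. (a i - z i)\<^sup>2) =
        (\<Sum>i<n. (a i - y i)\<^sup>2 + 2 * ((a i - y i) * (y i - z i)) + (y i - z i)\<^sup>2)"
      by (intro sum.cong refl) (simp add: power2_eq_square algebra_simps)
    then have "(\<Sum>i<n. (a i - z i)\<^sup>2) =
        (\<Sum>i<n. (a i - y i)\<^sup>2) + 2 * (\<Sum>i<n. (a i - y i) * (y i - z i)) + (\<Sum>i<n. (y i - z i)\<^sup>2)"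
      by (simp add: sum.distrib sum_distrib_left)
    ultimately have "(\<Sum>i<n. (a i - y i)\<^sup>2) < (\<Sum>i<n. (a i - z i)\<^sup>2)"
      using variational by linarith
    then show ?thesis
      by (simp add: d_def L2_set_def)
  qed
  have "arg_min_on d (unit_simplex n) = y"
    unfolding arg_min_on_def arg_min_def
  proof (rule some_equality)
    show "is_arg_min d (\<lambda>z. z \<in> unit_simplex n) y"
      unfolding is_arg_min_def using y_in closer by (metis less_asym)
    show "z = y" if "is_arg_min d (\<lambda>z. z \<in> unit_simplex n) z" for z
      using that y_in closer unfolding is_arg_min_def by metis
  qed
  then show ?thesis
    by (simp add: euclidean_projection_def d_def y_def)
qed

text \<open>
  If \<open>\<gamma>\<close> were larger than \<open>m = (1 - u) * \<alpha> + u * \<beta>\<close>, then thresholding the convex combination at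
  \<open>m\<close> would leave more than mass 1, but by convexity of \<open>max 0\<close> it leaves at most
  \<open>(1 - u) * 1 + u * 1\<close>.
\<close>

lemma simplex_threshold_convex:
  fixes a b :: "nat \<Rightarrow> real"
  assumes \<alpha>: "(\<Sum>i<n. max 0 (a i - \<alpha>)) = 1"
    and \<beta>: "(\<Sum>i<n. max 0 (b i - \<beta>)) = 1"
    and \<gamma>: "(\<Sum>i<n. max 0 ((1 - u) * a i + u * b i - \<gamma>)) = 1"
    and u: "0 \<le> u" "u \<le> 1"
  shows "\<gamma> \<le> (1 - u) * \<alpha> + u * \<beta>"
proof (rule ccontr)
  define m where "m = (1 - u) * \<alpha> + u * \<beta>"
  define c where "c i = (1 - u) * a i + u * b i" for i
  assume "\<not> ?thesis"
  then have less: "m < \<gamma>"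
    by (simp add: m_def)
  have "\<exists>j<n. max 0 (c j - \<gamma>) \<noteq> 0"
    using \<gamma> unfolding c_def by (metis (no_types, lifting) lessThan_iff sum.neutral zero_neq_one)
  then obtain j where j: "j < n" "\<gamma> < c j"
    by (auto simp: max_def split: if_splits)
  have "1 = (\<Sum>i<n. max 0 (c i - \<gamma>))"
    using \<gamma> by (simp add: c_def)
  also have "\<dots> < (\<Sum>i<n. max 0 (c i - m))"
    using less j by (intro sum_strict_mono_ex1) (auto intro!: bexI[of _ j])
  also have "\<dots> \<le> (\<Sum>i<n. (1 - u) * max 0 (a i - \<alpha>) + u * max 0 (b i - \<beta>))"
  proof (intro sum_mono)
    fix i
    have "c i - m = (1 - u) * (a i - \<alpha>) + u * (b i - \<beta>)"
      by (simp add: c_def m_def algebra_simps)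
    also have "\<dots> \<le> (1 - u) * max 0 (a i - \<alpha>) + u * max 0 (b i - \<beta>)"
      using u by (intro add_mono mult_left_mono) auto
    finally show "max 0 (c i - m) \<le> (1 - u) * max 0 (a i - \<alpha>) + u * max 0 (b i - \<beta>)"
      using u by simp
  qed
  also have "\<dots> = 1"
    using \<alpha> \<beta> by (simp add: sum.distrib flip: sum_distrib_left)
  finally show False
    by simp
qed

section \<open>The support along the projections curve\<close>

lemma projections_curve_threshold:
  fixes x0 w :: "nat \<Rightarrow> real"
  assumes "0 < n"
  shows "\<exists>\<mu>. (\<forall>t. (\<Sum>i<n. max 0 (x0 i - t * w i - \<mu> t)) = 1) \<and>
    (\<forall>t i. projections_curve n x0 w t i = (if i < n then max 0 (x0 i - t * w i - \<mu> t) else 0))"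
proof -
  have "\<forall>t. \<exists>m. (\<Sum>i<n. max 0 (x0 i - t * w i - m)) = 1"
    by (intro allI simplex_threshold_exists[OF assms])
  then obtain \<mu> where \<mu>: "\<And>t. (\<Sum>i<n. max 0 (x0 i - t * w i - \<mu> t)) = 1"
    by metis
  have "projections_curve n x0 w t i = (if i < n then max 0 (x0 i - t * w i - \<mu> t) else 0)" for t i
    unfolding projections_curve_def using euclidean_projection_unit_simplex[OF \<mu>] by simp
  with \<mu> show ?thesis
    by blast
qed

text \<open>
  Coordinate \<open>i\<close> is positive where the affine function \<open>x0 i - t * w i\<close> exceeds the threshold,
  which is convex in \<open>t\<close>.
\<close>

lemma is_interval_positive_coordinate:
  assumes "0 < n" "i < n"
  shows "is_interval {t. 0 \<le> t \<and> 0 < projections_curve n x0 w t i}"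
proof -
  obtain \<mu> where \<mu>: "\<And>t. (\<Sum>i<n. max 0 (x0 i - t * w i - \<mu> t)) = 1"
    and g: "\<And>t i. projections_curve n x0 w t i =
              (if i < n then max 0 (x0 i - t * w i - \<mu> t) else 0)"
    using projections_curve_threshold[OF assms(1)] by blast
  have between: "0 < projections_curve n x0 w t i"
    if "0 < projections_curve n x0 w r i" "0 < projections_curve n x0 w s i" "r < t" "t < s" for r s t
  proof -
    define u where "u = (t - r) / (s - r)"
    have u: "0 < u" "u < 1"
      using that by (simp_all add: u_def)
    have "u * (s - r) = t - r"
      using that by (simp add: u_def)
    then have t: "t = (1 - u) * r + u * s"
      by (simp add: algebra_simps)
    have comb: "x0 j - t * w j = (1 - u) * (x0 j - r * w j) + u * (x0 j - s * w j)" for j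
      by (simp add: t algebra_simps)
    have "\<mu> t \<le> (1 - u) * \<mu> r + u * \<mu> s"
      using simplex_threshold_convex[OF \<mu>[of r] \<mu>[of s]] \<mu>[of t] u by (simp add: comb)
    also have "\<dots> < (1 - u) * (x0 i - r * w i) + u * (x0 i - s * w i)"
      using that(1,2) u assms(2) by (intro add_strict_mono mult_strict_left_mono) (auto simp: g)
    finally show ?thesis
      using assms(2) by (simp add: g comb)
  qed
  show ?thesis
    unfolding is_interval_1
  proof (intro ballI allI impI)
    fix r s t
    assume "r \<in> {t. 0 \<le> t \<and> 0 < projections_curve n x0 w t i}"
      and "s \<in> {t. 0 \<le> t \<and> 0 < projections_curve n x0 w t i}" and "r \<le> t \<and> t \<le> s"
    then show "t \<in> {t. 0 \<le> t \<and> 0 < projections_curve n x0 w t i}"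
      using between[of r s t] by (cases "r = t \<or> t = s") (force, simp)
  qed
qed

text \<open>
  With a fixed support \<open>S\<close>, the mass condition reads
  \<open>(\<Sum>i\<in>S. x0 i - t * w i) - card S * \<mu> = 1\<close>, which makes the threshold affine in \<open>t\<close>.
\<close>

lemma affine_curve_on_constant_support:
  assumes "0 < n"
    and supp: "\<And>t i. t \<in> U \<Longrightarrow> i < n \<Longrightarrow> 0 < projections_curve n x0 w t i \<longleftrightarrow> i \<in> S"
  shows "affine_curve_on U (projections_curve n x0 w)"
proof -
  obtain \<mu> where \<mu>: "\<And>t. (\<Sum>i<n. max 0 (x0 i - t * w i - \<mu> t)) = 1"
    and g: "\<And>t i. projections_curve n x0 w t i =
              (if i < n then max 0 (x0 i - t * w i - \<mu> t) else 0)"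
    using projections_curve_threshold[OF assms(1)] by blast
  define R where "R = {..<n} \<inter> S"
  define k where "k = real (card R)"
  define A where "A = ((\<Sum>i\<in>R. x0 i) - 1) / k"
  define B where "B = (\<Sum>i\<in>R. w i) / k"
  have cut: "max 0 (x0 i - t * w i - \<mu> t) = (if i \<in> S then x0 i - t * w i - \<mu> t else 0)"
    if "t \<in> U" "i < n" for t i
    using supp[OF that] that(2) by (auto simp: g)
  have threshold: "\<mu> t = A - t * B" if t: "t \<in> U" for t
  proof -
    have "1 = (\<Sum>i<n. if i \<in> S then x0 i - t * w i - \<mu> t else 0)"
      using \<mu>[of t] cut[OF t] by simp
    also have "\<dots> = (\<Sum>i\<in>R. x0 i - t * w i - \<mu> t)"
      by (simp add: R_def sum.inter_restrict)
    finally have mass: "1 = (\<Sum>i\<in>R. x0 i - t * w i - \<mu> t)" .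
    then have "R \<noteq> {}"
      by auto
    then have k: "k \<noteq> 0"
      by (simp add: k_def R_def)
    have "1 = (\<Sum>i\<in>R. x0 i) - t * (\<Sum>i\<in>R. w i) - k * \<mu> t"
      using mass by (simp add: sum_subtractf sum_distrib_left k_def)
    moreover have "k * A = (\<Sum>i\<in>R. x0 i) - 1" "k * B = (\<Sum>i\<in>R. w i)"
      using k by (simp_all add: A_def B_def)
    ultimately have "k * \<mu> t = k * A - t * (k * B)"
      by simp
    then have "k * \<mu> t = k * (A - t * B)"
      by (simp add: algebra_simps)
    then show ?thesis
      using k by simp
  qed
  define a where "a i = (if i \<in> R then x0 i - A else 0)" for i
  define b where "b i = (if i \<in> R then B - w i else 0)" for i
  have "projections_curve n x0 w t i = a i + t * b i" if "t \<in> U" for t i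
    using cut[OF that, of i] threshold[OF that]
    by (auto simp: g a_def b_def R_def algebra_simps)
  then show ?thesis
    unfolding affine_curve_on_def by blast
qed

text \<open>
  Near any time \<open>p \<ge> 0\<close> outside these frontiers the support does not change, so the curve is
  affine around \<open>p\<close>. Such a \<open>p\<close> is not \<open>0\<close>: some coordinate is positive at \<open>p\<close>, and \<open>0\<close> lies on
  the frontier of the interval of every coordinate that is positive there.
\<close>

lemma breakpoints_projections_curve_subset:
  assumes n: "0 < n"
  shows "breakpoints (projections_curve n x0 w) \<subseteq>
           (\<Union>i<n. frontier {t. 0 \<le> t \<and> 0 < projections_curve n x0 w t i})"
proof
  define g where "g = projections_curve n x0 w"
  define P where "P i = {t. 0 \<le> t \<and> 0 < g t i}" for i
  fix p assume "p \<in> breakpoints (projections_curve n x0 w)"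
  then obtain I where I: "maximal_nonconst_affine_interval g I" and p: "p \<in> frontier I"
    by (auto simp: breakpoints_def g_def)
  have "I \<subseteq> {0..}"
    using I by (auto simp: maximal_nonconst_affine_interval_def nonconst_affine_interval_def)
  then have "closure I \<subseteq> {0..}"
    by (intro closure_minimal) auto
  then have p_nonneg: "0 \<le> p"
    using p by (auto simp: frontier_def)
  have "p \<in> (\<Union>i<n. frontier (P i))"
  proof (rule ccontr)
    assume not_frontier: "\<not> ?thesis"
    have "\<forall>\<^sub>F t in nhds p. t \<in> P i \<longleftrightarrow> p \<in> P i" if "i < n" for i
    proof (cases "p \<in> P i")
      case True
      then have "p \<in> interior (P i)"
        using not_frontier that closure_subset[of "P i"] by (auto simp: frontier_def)
      then have "\<forall>\<^sub>F t in nhds p. t \<in> interior (P i)"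
        by (simp add: eventually_nhds_in_open)
      then show ?thesis
        by eventually_elim (use True interior_subset in blast)
    next
      case False
      then have "p \<in> - closure (P i)"
        using not_frontier that interior_subset[of "P i"] by (auto simp: frontier_def)
      then have "\<forall>\<^sub>F t in nhds p. t \<in> - closure (P i)"
        by (intro eventually_nhds_in_open) auto
      then show ?thesis
        by eventually_elim (use False closure_subset in blast)
    qed
    then have "\<forall>\<^sub>F t in nhds p. \<forall>i\<in>{..<n}. t \<in> P i \<longleftrightarrow> p \<in> P i"
      by (intro eventually_ball_finite) auto
    then obtain e where e: "0 < e" "\<And>t i. t \<in> ball p e \<Longrightarrow> i < n \<Longrightarrow> t \<in> P i \<longleftrightarrow> p \<in> P i"
      unfolding eventually_nhds_metric by (auto simp: dist_commute)
    obtain j where j: "j < n" "0 < g p j"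
    proof -
      obtain \<mu> where \<mu>: "\<And>t. (\<Sum>i<n. max 0 (x0 i - t * w i - \<mu> t)) = 1"
        and g: "\<And>t i. g t i = (if i < n then max 0 (x0 i - t * w i - \<mu> t) else 0)"
        unfolding g_def using projections_curve_threshold[OF n] by blast
      have "(\<Sum>i<n. g p i) = 1"
        using \<mu>[of p] by (simp add: g)
      then show ?thesis
        using that by (metis lessThan_iff not_less sum_nonpos zero_less_one)
    qed
    then have nonneg: "ball p e \<subseteq> {0..}"
      using e(2)[OF _ j(1)] p_nonneg by (auto simp: P_def)
    have "affine_curve_on (ball p e) g"
      unfolding g_def
    proof (rule affine_curve_on_constant_support[OF n, where S = "{i. p \<in> P i}"])
      show "0 < projections_curve n x0 w t i \<longleftrightarrow> i \<in> {i. p \<in> P i}" if "t \<in> ball p e" "i < n" for t i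
        using e(2)[OF that] nonneg that(1) by (auto simp: P_def g_def)
    qed
    then have "ball p e \<inter> frontier I = {}"
      using nonneg by (intro disjoint_frontier_maximal_nonconst_affine_interval[OF I])
        (auto simp: is_interval_convex_1)
    moreover have "p \<in> ball p e"
      using e(1) by simp
    ultimately show False
      using p by blast
  qed
  then show "p \<in> (\<Union>i<n. frontier {t. 0 \<le> t \<and> 0 < projections_curve n x0 w t i})"
    by (simp add: P_def g_def)
qed

theorem theorem6:
  shows "\<exists>C::real. \<forall>(n::nat) x0 w.
           x0 \<in> unit_simplex n \<longrightarrow> w \<in> topspace (Euclidean_space n) \<longrightarrow>
             finite (breakpoints (projections_curve n x0 w)) \<and>
             real (card (breakpoints (projections_curve n x0 w))) \<le> C * real n"
proof (intro exI[of _ 2] allI impI)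
  fix n :: nat and x0 w :: "nat \<Rightarrow> real"
  assume "x0 \<in> unit_simplex n"
  \<comment> \<open>The simplex of dimension \<open>n - 1\<close> is empty for \<open>n = 0\<close>.\<close>
  then have n: "0 < n"
    by (cases n) (auto simp: unit_simplex_def)
  define F where "F i = frontier {t. 0 \<le> t \<and> 0 < projections_curve n x0 w t i}" for i
  have F: "finite (F i)" "card (F i) \<le> 2" if "i < n" for i
    using card_frontier_is_interval_le_2[OF is_interval_positive_coordinate[OF n that]]
    by (auto simp: F_def)
  have sub: "breakpoints (projections_curve n x0 w) \<subseteq> (\<Union>i<n. F i)"
    using breakpoints_projections_curve_subset[OF n] by (simp add: F_def)
  have fin: "finite (\<Union>i<n. F i)"
    using F(1) by auto
  have "card (breakpoints (projections_curve n x0 w)) \<le> card (\<Union>i<n. F i)"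
    by (rule card_mono[OF fin sub])
  also have "\<dots> \<le> (\<Sum>i<n. card (F i))"
    by (rule card_UN_le) simp
  also have "\<dots> \<le> (\<Sum>i<n. 2)"
    using F(2) by (intro sum_mono) simp
  finally have "card (breakpoints (projections_curve n x0 w)) \<le> 2 * n"
    by simp
  then show "finite (breakpoints (projections_curve n x0 w)) \<and>
      real (card (breakpoints (projections_curve n x0 w))) \<le> 2 * real n"
    using finite_subset[OF sub fin] by simp
qed

end
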